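(* Let $\mathcal{C}$ be any good coloring of any triangulation of the $2$-sphere in which all vertices have degree $6$ except exactly three vertices, which have degree $2$. Let $f$ be the fold count of $\mathcal{C}$ and $F$ the number of faces of the triangulation. Then $f^2/F\geq 3$.
   Context: A good coloring of a triangulation is a coloring of its faces black and white such that around each vertex the number of black faces is congruent mod $3$ to the number of white faces. The fold count of a good coloring is the number of edges whose two incident faces have different colors. *)

theory Defs
  imports "HOL-Analysis.Analysis" "HOL-Number_Theory.Cong"
begin

text \<open>
  Triangulations of the 2-sphere are understood in the general sense of finitely many triangles
  glued along their sides in pairs; two triangles may share several sides, as they must
  around a vertex of degree 2.

  A triangulation is given by a finite set \<open>F\<close> of faces, a gluing \<open>g\<close> of their sides and a
  characteristic map \<open>q\<close> onto the sphere. Every face is a copy of the standard triangle in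
  \<open>real^3\<close>, whose corners are indexed by the type \<open>3\<close>, i.e. cyclically by the integers modulo 3.
  The sphere being orientable, we take the corners of each face to be numbered
  counterclockwise. A pair \<open>(t, i)\<close> stands both for the corner \<open>i\<close> of the face \<open>t\<close> and for the
  side of \<open>t\<close> directed from the corner \<open>i\<close> to the corner \<open>i + 1\<close>. Sides that are glued together
  then run in opposite directions.
\<close>

definition std_triangle :: "(real^3) set" where
  "std_triangle = convex hull (range (\<lambda>i::3. axis i 1))"

definition sides :: "'f set \<Rightarrow> ('f \<times> 3) set" where
  "sides F = F \<times> UNIV"

definition corner_point :: "'f \<times> 3 \<Rightarrow> 'f \<times> (real^3)" where
  "corner_point d = (fst d, axis (snd d) 1)"

definition side_point :: "'f \<times> 3 \<Rightarrow> real \<Rightarrow> 'f \<times> (real^3)" where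
  "side_point d s = (fst d, (1 - s) *\<^sub>R axis (snd d) 1 + s *\<^sub>R axis (snd d + 1) 1)"

definition side_gluing :: "'f set \<Rightarrow> ('f \<times> 3 \<Rightarrow> 'f \<times> 3) \<Rightarrow> bool" where
  "side_gluing F g \<longleftrightarrow> (\<forall>d\<in>sides F. g d \<in> sides F \<and> g (g d) = d \<and> g d \<noteq> d)"

definition glue_rel ::
  "'f set \<Rightarrow> ('f \<times> 3 \<Rightarrow> 'f \<times> 3) \<Rightarrow> (('f \<times> (real^3)) \<times> ('f \<times> (real^3))) set" where
  "glue_rel F g = {(side_point d s, side_point (g d) (1 - s)) | d s. d \<in> sides F \<and> s \<in> {0..1}}"

text \<open>
  The condition on \<open>q\<close> says that the quotient of the disjoint union of the triangles by the
  equivalence relation generated by the gluing is homeomorphic, via \<open>q\<close>, to the unit sphere.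
  (For a side gluing \<open>glue_rel F g\<close> is symmetric, so its reflexive transitive closure is that
  equivalence relation.)
\<close>

definition sphere_triangulation ::
  "'f set \<Rightarrow> ('f \<times> 3 \<Rightarrow> 'f \<times> 3) \<Rightarrow> ('f \<times> (real^3) \<Rightarrow> real^3) \<Rightarrow> bool" where
  "sphere_triangulation F g q \<longleftrightarrow>
     finite F \<and> side_gluing F g \<and>
     quotient_map (prod_topology (discrete_topology F) (top_of_set std_triangle))
       (top_of_set (sphere 0 1)) q \<and>
     (\<forall>x\<in>F \<times> std_triangle. \<forall>y\<in>F \<times> std_triangle. q x = q y \<longleftrightarrow> (x, y) \<in> (glue_rel F g)\<^sup>*)"

definition vertices :: "'f set \<Rightarrow> ('f \<times> (real^3) \<Rightarrow> real^3) \<Rightarrow> (real^3) set" where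
  "vertices F q = (\<lambda>d. q (corner_point d)) ` sides F"

definition corners_at :: "'f set \<Rightarrow> ('f \<times> (real^3) \<Rightarrow> real^3) \<Rightarrow> real^3 \<Rightarrow> ('f \<times> 3) set" where
  "corners_at F q v = {d \<in> sides F. q (corner_point d) = v}"

text \<open>
  An edge is a pair \<open>{d, g d}\<close> of glued sides, one starting at either end of the edge. So the
  edge ends at \<open>v\<close> correspond to the directed sides starting at \<open>v\<close>, i.e. to \<open>corners_at F q v\<close>.
\<close>

definition vertex_degree :: "'f set \<Rightarrow> ('f \<times> (real^3) \<Rightarrow> real^3) \<Rightarrow> real^3 \<Rightarrow> nat" where
  "vertex_degree F q v = card (corners_at F q v)"

definition edges :: "'f set \<Rightarrow> ('f \<times> 3 \<Rightarrow> 'f \<times> 3) \<Rightarrow> ('f \<times> 3) set set" where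
  "edges F g = (\<lambda>d. {d, g d}) ` sides F"

text \<open>
  A coloring is a predicate on faces, true on the black ones. The faces around a vertex are
  counted by their corners there.
\<close>

definition good_coloring :: "'f set \<Rightarrow> ('f \<times> (real^3) \<Rightarrow> real^3) \<Rightarrow> ('f \<Rightarrow> bool) \<Rightarrow> bool" where
  "good_coloring F q black \<longleftrightarrow>
     (\<forall>v\<in>vertices F q.
        [card {d \<in> corners_at F q v. black (fst d)} =
         card {d \<in> corners_at F q v. \<not> black (fst d)}] (mod 3))"

definition fold_count :: "'f set \<Rightarrow> ('f \<times> 3 \<Rightarrow> 'f \<times> 3) \<Rightarrow> ('f \<Rightarrow> bool) \<Rightarrow> nat" where
  "fold_count F g black =
     card {e \<in> edges F g. \<exists>d\<in>e. \<exists>d'\<in>e. black (fst d) \<noteq> black (fst d')}"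

end

theory Submission
  imports Defs
begin

text \<open>
  Folding along the edges between faces of different colors maps the sphere to the plane
  triangulated by unit triangles, simplicially and preserving the orientation of exactly the black
  faces. Goodness of the coloring, together with the even degrees, says that this map closes up
  around every vertex, and it is then globally defined because the first cohomology of the sphere
  vanishes. The images of the black faces, counted with multiplicity, form a 2-chain with \<open>F_b\<close>
  triangles whose boundary consists of at most \<open>f\<close> edges, so \<open>6 F_b \<le> f\<^sup>2\<close> by the isoperimetric
  inequality of the triangular lattice, in which hexagons are extremal. The same holds for
  the white faces, and adding up gives \<open>3 F \<le> f\<^sup>2\<close>.

  The cohomology vanishes by Euler's formula (supplied by the degrees) and the connectedness of the
  dual graph. The isoperimetric inequality reduces, level set by level set, to bounding the number
  of triples \<open>(a, b, c)\<close> in \<open>X \<times> Y \<times> Z\<close> with \<open>a + b + c \<in> {0, - 1}\<close> for finite sets of integers.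
\<close>

section \<open>Triples of integers with sum \<open>0\<close> or \<open>- 1\<close>\<close>

text \<open>Each count is at most the smaller cardinality. If the cardinalities agree, not both
  counts are full: \<open>Z\<close> would be both \<open>- H\<close> and \<open>- H - 1\<close>, but
  no finite nonempty set is invariant under a shift by one.\<close>

lemma two_translates_bound:
  fixes H Z :: "int set"
  assumes fin: "finite H" "finite Z" and ne: "H \<noteq> {}"
  shows "int (card {s\<in>H. - s \<in> Z} + card {s\<in>H. - s - 1 \<in> Z})
    \<le> int (card Z) + int (card H) - max \<bar>int (card H) - int (card Z)\<bar> 1"
proof -
  let ?A = "{s\<in>H. - s \<in> Z}" and ?B = "{s\<in>H. - s - 1 \<in> Z}"
  have AH: "card ?A \<le> card H" and BH: "card ?B \<le> card H"
    by (auto intro: card_mono fin)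
  have AZ: "card ?A \<le> card Z"
    by (rule card_inj_on_le[of uminus]) (auto simp: inj_on_def fin)
  have BZ: "card ?B \<le> card Z"
    by (rule card_inj_on_le[of "\<lambda>s. - s - 1"]) (auto simp: inj_on_def fin)
  have "card ?A + card ?B < 2 * card H" if "card Z = card H"
  proof (rule ccontr)
    assume "\<not> ?thesis"
    then have "card ?A = card H" "card ?B = card H" using AH BH by auto
    then have A: "?A = H" and B: "?B = H"
      using card_subset_eq[OF fin(1), of ?A] card_subset_eq[OF fin(1), of ?B] by blast+
    have "uminus ` H = Z"
      by (rule card_subset_eq) (use A that in \<open>auto simp: fin card_image\<close>)
    have "Max H \<in> H" using Max_in fin ne by blast
    then have "- Max H - 1 \<in> Z" using B by blast
    then obtain s where "s \<in> H" "- Max H - 1 = - s" using \<open>uminus ` H = Z\<close> by blast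
    then have "Max H + 1 \<in> H" by (simp add: algebra_simps)
    then show False using Max_ge[OF fin(1), of "Max H + 1"] by simp
  qed
  then show ?thesis using AH BH AZ BZ by linarith
qed

text \<open>
  Splitting a grid of \<open>x\<close> by \<open>y\<close> pairs into hooks of \<open>x + y - 1 - 2 i\<close> pairs with distinct sums,
  for \<open>i < min x y\<close>, and applying the preceding bound to every hook leads to a sum of terms
  \<open>max \<bar>x + y - 1 - 2 i - z\<bar> 1\<close>. The function below turns a lower bound for it into a telescoping sum.
\<close>

definition signed_quarter_square :: "int \<Rightarrow> real" where
  "signed_quarter_square u = real_of_int (u * \<bar>u\<bar>) / 4"

lemma signed_quarter_square_step:
  "signed_quarter_square (h + 1) - signed_quarter_square (h - 1) \<le> max \<bar>real_of_int h\<bar> 1"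
proof -
  consider "h \<ge> 1" | "h = 0" | "h \<le> - 1" by linarith
  then show ?thesis
  proof cases
    case 3
    then have "h + 1 \<le> 0" "h - 1 < 0" "of_int h \<le> (- 1 :: real)" by linarith+
    then show ?thesis
      by (simp add: signed_quarter_square_def abs_of_nonpos abs_of_neg field_simps)
  qed (auto simp: signed_quarter_square_def abs_if field_simps)
qed

text \<open>Bounds the sum of \<open>z + h - max \<bar>h - z\<bar> 1\<close> over all hooks,
  \<open>h\<close> being the size of the hook: the sizes add up to \<open>x * y\<close>, and the
  quarter squares telescope in steps of two.\<close>

definition triple_bound :: "int \<Rightarrow> int \<Rightarrow> int \<Rightarrow> real" where
  "triple_bound x y z = of_int (min x y * z + x * y)
     - signed_quarter_square (x + y - z) + signed_quarter_square (\<bar>x - y\<bar> - z)"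

text \<open>For \<open>x \<le> y\<close> there are three regimes. If \<open>z\<close> is large or
  small, the bound degenerates to \<open>2 * x * y\<close> or \<open>2 * x * z\<close>. In between,
  the defect is a sum of squares vanishing at \<open>x = y = z\<close>, the proportions of a regular
  hexagon.\<close>

lemma triple_bound_le:
  assumes "x \<ge> 0" "y \<ge> 0" "z \<ge> 0"
  shows "6 * triple_bound x y z \<le> of_int ((x + y + z)\<^sup>2)"
proof -
  have main: "6 * triple_bound x y z \<le> of_int ((x + y + z)\<^sup>2)"
    if xy: "x \<le> y" and nn: "x \<ge> 0" "y \<ge> 0" "z \<ge> 0" for x y z
  proof -
    define X Y Z where d: "X = real_of_int x" "Y = real_of_int y" "Z = real_of_int z"
    have r: "X \<le> Y" "X \<ge> 0" "Y \<ge> 0" "Z \<ge> 0" using that by (auto simp: d)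
    consider "z > x + y" | "z < y - x" | "y - x \<le> z" "z \<le> x + y" by linarith
    then show ?thesis
    proof cases
      case 1
      then have "Z > X + Y" by (simp add: d flip: of_int_add)
      then have "(X + Y + Z)\<^sup>2 \<ge> (2 * (X + Y))\<^sup>2"
        using r by (intro power_mono) auto
      moreover have "0 \<le> (X - Y)\<^sup>2" "0 \<le> X * Y" using r by auto
      ultimately have "12 * (X * Y) \<le> (X + Y + Z)\<^sup>2"
        by (simp add: power2_eq_square algebra_simps)
      moreover have "triple_bound x y z = 2 * (X * Y)"
        using 1 xy nn by (simp add: triple_bound_def signed_quarter_square_def d abs_if min_def field_simps)
      ultimately show ?thesis by (simp add: d)
    next
      case 2
      then have "Z < Y - X" by (simp add: d flip: of_int_diff)
      then have "(X + Y + Z)\<^sup>2 \<ge> (2 * (X + Z))\<^sup>2"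
        using r by (intro power_mono) auto
      moreover have "0 \<le> (X - Z)\<^sup>2" "0 \<le> X * Z" using r by auto
      ultimately have "12 * (X * Z) \<le> (X + Y + Z)\<^sup>2"
        by (simp add: power2_eq_square algebra_simps)
      moreover have "triple_bound x y z = 2 * (X * Z)"
        using 2 xy nn by (simp add: triple_bound_def signed_quarter_square_def d abs_if min_def field_simps)
      ultimately show ?thesis by (simp add: d)
    next
      case 3
      then have "\<bar>x + y - z\<bar> = x + y - z" "\<bar>x - y\<bar> = y - x" "\<bar>y - x - z\<bar> = z - (y - x)"
        "min x y = x"
        using xy by auto
      then have "triple_bound x y z = (X + Y) * Z - Z\<^sup>2 / 2 - (Y - X)\<^sup>2 / 2"
        by (simp add: triple_bound_def signed_quarter_square_def d field_simps power2_eq_square)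
      moreover have "(X + Y + Z)\<^sup>2 - 6 * ((X + Y) * Z - Z\<^sup>2 / 2 - (Y - X)\<^sup>2 / 2)
          = (X + Y - 2 * Z)\<^sup>2 + 3 * (Y - X)\<^sup>2"
        by (simp add: power2_eq_square field_simps)
      moreover have "0 \<le> (X + Y - 2 * Z)\<^sup>2 + 3 * (Y - X)\<^sup>2" by simp
      ultimately have "6 * triple_bound x y z \<le> (X + Y + Z)\<^sup>2"
        by (metis diff_ge_0_iff_ge)
      then show ?thesis by (simp add: d)
    qed
  qed
  have sym: "triple_bound y x z = triple_bound x y z"
    by (simp add: triple_bound_def min.commute algebra_simps abs_minus_commute)
  show ?thesis
    using main[of x y z] main[of y x z] assms sym by (cases "x \<le> y") (auto simp: add.commute)
qed

text \<open>Removing the outermost hook, of \<open>x + y - 1\<close> pairs, preserves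
  \<open>x - y\<close>, so only the first quarter square changes.\<close>

lemma triple_bound_step:
  assumes "x \<ge> 1" "y \<ge> 1"
  shows "triple_bound (x - 1) (y - 1) z + of_int (z + (x + y - 1) - max \<bar>x + y - 1 - z\<bar> 1)
     \<le> triple_bound x y z"
proof -
  have "signed_quarter_square (x + y - z) - signed_quarter_square (x + y - 2 - z)
     \<le> max \<bar>of_int (x + y - 1 - z)\<bar> 1"
    using signed_quarter_square_step[of "x + y - 1 - z"] by (simp add: algebra_simps)
  then show ?thesis
    by (auto simp: triple_bound_def algebra_simps min_def split: if_splits)
qed

text \<open>The weight of a pair depends only on its sum. Induction peels off one hook at a time;
  \<open>two_translates_bound\<close> applies to its set of sums.\<close>

lemma pair_sum_count_bound:
  fixes X Y Z :: "int set"
  assumes "finite X" "finite Y" "finite Z"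
  shows "real (\<Sum>(a,b)\<in>X \<times> Y. of_bool (- (a + b) \<in> Z) + of_bool (- (a + b) - 1 \<in> Z))
    \<le> triple_bound (card X) (card Y) (card Z)"
  using assms
proof (induction "card X" arbitrary: X Y)
  case 0
  then show ?case by (simp add: triple_bound_def)
next
  case (Suc n)
  define w :: "int \<Rightarrow> nat" where "w s = of_bool (- s \<in> Z) + of_bool (- s - 1 \<in> Z)" for s
  show ?case
  proof (cases "Y = {}")
    case True
    then show ?thesis by (simp add: triple_bound_def)
  next
    case False
    have Xne: "X \<noteq> {}" using Suc.hyps by auto
    define a0 b0 where "a0 = Min X" and "b0 = Max Y"
    define X' Y' where "X' = X - {a0}" and "Y' = Y - {b0}"
    have a0: "a0 \<in> X" "\<And>a. a \<in> X \<Longrightarrow> a0 \<le> a" and b0: "b0 \<in> Y" "\<And>b. b \<in> Y \<Longrightarrow> b \<le> b0"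
      using Suc.prems Xne False by (auto simp: a0_def b0_def)
    have cX: "card X' = card X - 1" "card X \<ge> 1" and cY: "card Y' = card Y - 1" "card Y \<ge> 1"
      using a0 b0 Suc.prems Xne False by (auto simp: X'_def Y'_def Suc_leI card_gt_0_iff)
    have fin': "finite X'" "finite Y'" using Suc.prems by (auto simp: X'_def Y'_def)
    \<comment> \<open>The sums along the outermost hook, the row of \<open>a0\<close> and the column of \<open>b0\<close>, are distinct.\<close>
    define H where "H = (\<lambda>b. a0 + b) ` Y \<union> (\<lambda>a. a + b0) ` X'"
    have disj: "(\<lambda>b. a0 + b) ` Y \<inter> (\<lambda>a. a + b0) ` X' = {}"
    proof -
      have "a0 + b < a + b0" if "b \<in> Y" "a \<in> X'" for a b
        using that a0(2)[of a] b0(2)[of b] by (auto simp: X'_def)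
      then show ?thesis by force
    qed
    have finH: "finite H" using Suc.prems fin' by (auto simp: H_def)
    have cH: "card H = card X + card Y - 1"
      unfolding H_def using disj Suc.prems fin' cX
      by (subst card_Un_disjoint) (auto simp: card_image inj_on_def)
    have "(\<Sum>(a,b)\<in>X \<times> Y. w (a + b)) = (\<Sum>a\<in>X. \<Sum>b\<in>Y. w (a + b))"
      by (simp add: sum.cartesian_product)
    also have "\<dots> = (\<Sum>b\<in>Y. w (a0 + b)) + (\<Sum>a\<in>X'. \<Sum>b\<in>Y. w (a + b))"
      unfolding X'_def by (rule sum.remove) (use Suc.prems a0 in auto)
    also have "(\<Sum>a\<in>X'. \<Sum>b\<in>Y. w (a + b)) = (\<Sum>a\<in>X'. w (a + b0) + (\<Sum>b\<in>Y'. w (a + b)))"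
      unfolding Y'_def by (intro sum.cong refl sum.remove) (use Suc.prems b0 in auto)
    also have "\<dots> = (\<Sum>a\<in>X'. w (a + b0)) + (\<Sum>(a,b)\<in>X' \<times> Y'. w (a + b))"
      by (simp add: sum.distrib sum.cartesian_product)
    finally have split: "(\<Sum>(a,b)\<in>X \<times> Y. w (a + b)) = 
        ((\<Sum>b\<in>Y. w (a0 + b)) + (\<Sum>a\<in>X'. w (a + b0))) + (\<Sum>(a,b)\<in>X' \<times> Y'. w (a + b))"
      by simp
    have "(\<Sum>b\<in>Y. w (a0 + b)) + (\<Sum>a\<in>X'. w (a + b0)) = sum w H"
      unfolding H_def using disj Suc.prems fin'
      by (subst sum.union_disjoint) (auto simp: sum.reindex inj_on_def)
    also have "\<dots> = card {s\<in>H. - s \<in> Z} + card {s\<in>H. - s - 1 \<in> Z}"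
      using finH by (simp add: w_def sum.distrib Collect_conj_eq Int_commute)
    finally have "int ((\<Sum>b\<in>Y. w (a0 + b)) + (\<Sum>a\<in>X'. w (a + b0)))
        \<le> int (card Z) + int (card H) - max \<bar>int (card H) - int (card Z)\<bar> 1"
      using two_translates_bound[of H Z] finH Suc.prems b0 by (auto simp: H_def)
    then have "real ((\<Sum>b\<in>Y. w (a0 + b)) + (\<Sum>a\<in>X'. w (a + b0)))
        \<le> of_int (int (card Z) + int (card H) - max \<bar>int (card H) - int (card Z)\<bar> 1)"
      by linarith
    moreover have "int (card H) = int (card X) + int (card Y) - 1"
      using cH cX by linarith
    moreover have "real (\<Sum>(a,b)\<in>X' \<times> Y'. w (a + b)) \<le> triple_bound (card X') (card Y') (card Z)"
      using Suc.hyps(1)[of X' Y'] Suc.hyps(2) cX fin' Suc.prems by (simp add: w_def)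
    moreover have "int (card X') = int (card X) - 1" "int (card Y') = int (card Y) - 1"
      using cX cY by auto
    ultimately have "real (\<Sum>(a,b)\<in>X \<times> Y. w (a + b)) \<le> triple_bound (card X) (card Y) (card Z)"
      using triple_bound_step[of "int (card X)" "int (card Y)" "int (card Z)"] cX cY
      unfolding split of_nat_add by simp
    then show ?thesis by (simp add: w_def)
  qed
qed

text \<open>A pair \<open>(a, b)\<close> leaves two candidates for \<open>c\<close>, namely
  \<open>- (a + b)\<close> and \<open>- (a + b) - 1\<close>.\<close>

lemma hexagonal_triple_count:
  fixes X Y Z :: "int set"
  assumes "finite X" "finite Y" "finite Z"
  shows "6 * card {(a, b, c). a \<in> X \<and> b \<in> Y \<and> c \<in> Z \<and> a + b + c \<in> {0, - 1}}
    \<le> (card X + card Y + card Z)\<^sup>2"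
proof -
  let ?T = "{(a, b, c). a \<in> X \<and> b \<in> Y \<and> c \<in> Z \<and> a + b + c \<in> {0, - 1}}"
  let ?P = "{(a, b) \<in> X \<times> Y. - (a + b) \<in> Z}" and ?Q = "{(a, b) \<in> X \<times> Y. - (a + b) - 1 \<in> Z}"
  have sub: "?T \<subseteq> (\<lambda>(a, b). (a, b, - (a + b))) ` ?P \<union> (\<lambda>(a, b). (a, b, - (a + b) - 1)) ` ?Q"
  proof clarify
    fix a b c
    assume *: "a \<in> X" "b \<in> Y" "c \<in> Z" "a + b + c \<in> {0, - 1}"
      "(a, b, c) \<notin> (\<lambda>(a, b). (a, b, - (a + b) - 1)) ` ?Q"
    then have "c = - (a + b) \<or> c = - (a + b) - 1" by auto
    with * show "(a, b, c) \<in> (\<lambda>(a, b). (a, b, - (a + b))) ` ?P" by (auto simp: image_iff)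
  qed
  have fin: "finite ?P" "finite ?Q"
    by (rule finite_subset[of _ "X \<times> Y"]; use assms in auto)+
  have "card ?T \<le> card ?P + card ?Q"
    using card_mono[OF _ sub] card_Un_le card_image_le[OF fin(1)] card_image_le[OF fin(2)] fin
    by (smt (verit, best) finite_UnI finite_imageI add_mono le_trans)
  also have "\<dots> = (\<Sum>(a,b)\<in>X \<times> Y. of_bool (- (a + b) \<in> Z) + of_bool (- (a + b) - 1 \<in> Z))"
  proof -
    have "?P = X \<times> Y \<inter> {p. - (fst p + snd p) \<in> Z}" "?Q = X \<times> Y \<inter> {p. - (fst p + snd p) - 1 \<in> Z}"
      by auto
    then show ?thesis using assms by (simp add: case_prod_unfold sum.distrib)
  qed
  finally have "real (card ?T) \<le> triple_bound (card X) (card Y) (card Z)"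
    using pair_sum_count_bound[OF assms] by linarith
  then have "real (6 * card ?T) \<le> of_int ((int (card X) + int (card Y) + int (card Z))\<^sup>2)"
    using triple_bound_le[of "card X" "card Y" "card Z"] by linarith
  also have "\<dots> = real ((card X + card Y + card Z)\<^sup>2)" by simp
  finally show ?thesis by (simp only: of_nat_le_iff)
qed

section \<open>Cocycles on the dual graph\<close>

definition next_side :: "'f \<times> 3 \<Rightarrow> 'f \<times> 3" where
  "next_side d = (fst d, snd d + 1)"

lemma fst_next_side [simp]: "fst (next_side d) = fst d"
  by (simp add: next_side_def)

lemma snd_next_side [simp]: "snd (next_side d) = snd d + 1"
  by (simp add: next_side_def)

lemma three_eq_0 [simp]: "(3::3) = 0"
  by simp

lemma next_side_3 [simp]: "next_side (next_side (next_side d)) = d"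
  by (simp add: next_side_def prod_eq_iff add.assoc)

lemma next_side_eq_iff [simp]: "next_side d = next_side e \<longleftrightarrow> d = e"
  by (metis next_side_3)

lemma sides_cases:
  assumes "fst d = fst (e::'f \<times> 3)"
  obtains "d = e" | "d = next_side e" | "d = next_side (next_side e)"
proof -
  have "snd d - snd e = 0 \<or> snd d - snd e = 1 \<or> snd d - snd e = 2"
    using exhaust_3[of "snd d - snd e"] by auto
  then have "snd d = snd e \<or> snd d = snd e + 1 \<or> snd d = snd e + 2"
    by (auto simp: algebra_simps)
  then show ?thesis
    using that assms by (auto simp: prod_eq_iff add.assoc)
qed

lemma mem_sides_iff [simp]: "d \<in> sides F \<longleftrightarrow> fst d \<in> F"
  by (cases d) (simp add: sides_def)

lemma card_sides: "card (sides F) = 3 * card F"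
  by (simp add: sides_def card_cartesian_product)

lemma finite_sides [simp]: "finite F \<Longrightarrow> finite (sides F)"
  by (simp add: sides_def)

text \<open>The combinatorial content of a triangulated sphere. \<open>vtx d\<close> is the vertex
  where \<open>d\<close> starts, hence where \<open>g d\<close> ends. Since the
  \<open>3 * card F\<close> sides form edges in pairs, \<open>euler\<close> says V - E + F =
  2.\<close>

locale euler_gluing =
  fixes F :: "'f set" and g :: "'f \<times> 3 \<Rightarrow> 'f \<times> 3" and vtx :: "'f \<times> 3 \<Rightarrow> 'v"
  assumes finite_faces: "finite F"
    and gluing: "side_gluing F g"
    and vtx_next_glue: "fst d \<in> F \<Longrightarrow> vtx (next_side (g d)) = vtx d"
    and dual_connected: "D \<subseteq> F \<Longrightarrow> D \<noteq> {} \<Longrightarrow> D \<noteq> F \<Longrightarrow> \<exists>d\<in>sides D. fst (g d) \<notin> D"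
    and euler: "2 * card (vtx ` sides F) = card F + 4"
begin

lemma glue_face [simp]: "fst d \<in> F \<Longrightarrow> fst (g d) \<in> F"
  and glue_glue [simp]: "fst d \<in> F \<Longrightarrow> g (g d) = d"
  and glue_neq [simp]: "fst d \<in> F \<Longrightarrow> g d \<noteq> d"
  using gluing by (auto simp: side_gluing_def)

lemma glue_inj: "fst d \<in> F \<Longrightarrow> fst e \<in> F \<Longrightarrow> g d = g e \<Longrightarrow> d = e"
  by (metis glue_glue)

lemma vtx_glue: "fst d \<in> F \<Longrightarrow> vtx (g d) = vtx (next_side d)"
  using vtx_next_glue[of "g d"] by simp

text \<open>Connectedness of a graph, phrased with two-valued labelings instead of paths: the sides
  of \<open>D\<close> outside \<open>K\<close> join all corners of \<open>D\<close>.\<close>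

definition linked :: "'f set \<Rightarrow> ('f \<times> 3) set \<Rightarrow> bool" where
  "linked D K \<longleftrightarrow> (\<forall>W :: 'v \<Rightarrow> bool. (\<forall>d. fst d \<in> D \<longrightarrow> d \<notin> K \<longrightarrow> W (vtx d) = W (vtx (next_side d))) \<longrightarrow>
     (\<forall>d e. fst d \<in> D \<longrightarrow> fst e \<in> D \<longrightarrow> W (vtx d) = W (vtx e)))"

lemma linkedI:
  assumes "\<And>(W :: 'v \<Rightarrow> bool) d e. \<lbrakk>\<And>d. fst d \<in> D \<Longrightarrow> d \<notin> K \<Longrightarrow> W (vtx d) = W (vtx (next_side d)); fst d \<in> D; fst e \<in> D\<rbrakk>
    \<Longrightarrow> W (vtx d) = W (vtx e)"
  shows "linked D K"
  using assms unfolding linked_def by blast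

lemma linkedD:
  fixes W :: "'v \<Rightarrow> bool"
  assumes "linked D K" "\<And>d. fst d \<in> D \<Longrightarrow> d \<notin> K \<Longrightarrow> W (vtx d) = W (vtx (next_side d))"
    "fst d \<in> D" "fst e \<in> D"
  shows "W (vtx d) = W (vtx e)"
  using assms(1)[unfolded linked_def, rule_format, of W d e] assms(2-) by blast

text \<open>
  A spanning tree of the dual graph, grown face by face. The faces it reaches form a disk, whose
  boundary consists of the sides outside the tree and runs through all of its corners.
\<close>

lemma spanning_tree:
  fixes c :: "'f \<times> 3 \<Rightarrow> 'a::ab_group_add"
  assumes c: "\<And>d. fst d \<in> F \<Longrightarrow> c (g d) = - c d"
    and n: "1 \<le> n" "n \<le> card F"
  shows "\<exists>D K h. D \<subseteq> F \<and> card D = n \<and> K \<subseteq> sides D \<and> g ` K \<subseteq> K \<and> card K = 2 * (n - 1) \<and>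
     (\<forall>d\<in>K. h (fst (g d)) = h (fst d) + c d) \<and> linked D K"
  using n
proof (induction n rule: dec_induct)
  case base
  then obtain t where t: "t \<in> F" by fastforce
  have "linked {t} {}"
  proof (rule linkedI)
    fix W :: "'v \<Rightarrow> bool" and d e :: "'f \<times> 3"
    assume W: "\<And>d. fst d \<in> {t} \<Longrightarrow> d \<notin> {} \<Longrightarrow> W (vtx d) = W (vtx (next_side d))"
      and de: "fst d \<in> {t}" "fst e \<in> {t}"
    have 1: "W (vtx e) = W (vtx (next_side e))" "W (vtx (next_side e)) = W (vtx (next_side (next_side e)))"
      using W[of e] W[of "next_side e"] de by simp_all
    have "fst d = fst e" using de by simp
    then show "W (vtx d) = W (vtx e)" by (rule sides_cases) (simp_all add: 1)
  qed
  then show ?case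
    using t by (intro exI[of _ "{t}"] exI[of _ "{}"] exI[of _ "\<lambda>_. 0"]) auto
next
  case (step n)
  then have "n \<le> card F" by simp
  from step.IH[OF this]
  obtain D K h where DK: "D \<subseteq> F" "card D = n" "K \<subseteq> sides D" "g ` K \<subseteq> K" "card K = 2 * (n - 1)"
    and h: "\<forall>d\<in>K. h (fst (g d)) = h (fst d) + c d"
    and conn: "linked D K"
    by blast
  have "D \<noteq> {}" "D \<noteq> F" using DK step by auto
  then obtain d0 where d0: "fst d0 \<in> D" "fst (g d0) \<notin> D"
    using dual_connected[OF DK(1)] by (metis mem_sides_iff)
  define t where "t = fst (g d0)"
  have d0F: "fst d0 \<in> F" using d0 DK by auto
  have tF: "t \<in> F" using d0F by (simp add: t_def)
  have finD: "finite D" using DK finite_faces finite_subset by blast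
  have finK: "finite K" using DK finD finite_subset by (metis finite_sides)
  have KD: "fst d \<in> D" if "d \<in> K" for d using that DK by auto
  have notK: "d0 \<notin> K" "g d0 \<notin> K"
    using KD[of "g d0"] DK(4) d0 by auto
  define D' K' where "D' = insert t D" and "K' = insert d0 (insert (g d0) K)"
  \<comment> \<open>The only tree edge reaching the new face forces the potential there.\<close>
  define h' where "h' = h(t := h (fst d0) + c d0)"
  have "card D' = Suc n" using DK d0 finD by (simp add: D'_def t_def)
  moreover have "card K' = 2 * (Suc n - 1)"
    using DK(5) finK notK glue_neq[OF d0F, symmetric] step.hyps by (simp add: K'_def)
  moreover have "D' \<subseteq> F" "K' \<subseteq> sides D'" "g ` K' \<subseteq> K'"
    using DK tF d0 d0F by (auto simp: D'_def K'_def t_def)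
  moreover have "h' (fst (g d)) = h' (fst d) + c d" if dK: "d \<in> K'" for d
  proof -
    have tn: "fst d0 \<noteq> t" using d0 by (auto simp: t_def)
    consider "d = d0" | "d = g d0" | "d \<in> K" using dK unfolding K'_def by blast
    then show ?thesis
    proof cases
      case 1
      then show ?thesis using tn by (simp add: h'_def flip: t_def)
    next
      case 2
      then have "fst (g d) = fst d0" "fst d = t" "c d = - c d0"
        using d0F c[OF d0F] by (simp_all add: t_def)
      then show ?thesis using tn by (simp add: h'_def)
    next
      case 3
      then have "fst d \<noteq> t" "fst (g d) \<noteq> t" using KD[of d] KD[of "g d"] DK(4) d0 by (auto simp: t_def)
      then show ?thesis using h 3 by (simp add: h'_def)
    qed
  qed
  moreover have "linked D' K'"
  proof (rule linkedI)
    fix W :: "'v \<Rightarrow> bool" and d e :: "'f \<times> 3"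
    assume W: "\<And>d. fst d \<in> D' \<Longrightarrow> d \<notin> K' \<Longrightarrow> W (vtx d) = W (vtx (next_side d))"
      and de: "fst d \<in> D'" "fst e \<in> D'"
    define a where "a = g d0"
    have at: "fst a = t" and va: "vtx a = vtx (next_side d0)" "vtx (next_side a) = vtx d0"
      using d0F vtx_glue[of d0] vtx_next_glue[of d0] by (auto simp: a_def t_def)
    have n1: "next_side a \<noteq> a" "next_side (next_side a) \<noteq> a"
      by (auto simp: prod_eq_iff add.assoc)
    \<comment> \<open>The side \<open>d0\<close> is lost as a link, but the other two sides of the
      new face still join its ends.\<close>
    have "next_side a \<notin> K'" "next_side (next_side a) \<notin> K'"
      using n1 at d0 KD[of "next_side a"] KD[of "next_side (next_side a)"]
      by (auto simp: K'_def a_def[symmetric] t_def[symmetric])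
    then have 1: "W (vtx (next_side a)) \<longleftrightarrow> W (vtx (next_side (next_side a)))"
       "W (vtx (next_side (next_side a))) \<longleftrightarrow> W (vtx a)"
      using W[of "next_side a"] W[of "next_side (next_side a)"] at by (auto simp: D'_def)
    have old: "W (vtx d) = W (vtx (next_side d))" if "fst d \<in> D" "d \<notin> K" for d
    proof (cases "d = d0")
      case True
      then show ?thesis using 1 va by simp
    next
      case False
      then show ?thesis using W[of d] that d0 by (auto simp: D'_def K'_def)
    qed
    have "W (vtx d) \<longleftrightarrow> W (vtx d0)" if "fst d \<in> D'" for d
    proof (cases "fst d = t")
      case True
      then have "fst d = fst a" using at by simp
      then show ?thesis by (rule sides_cases) (use 1 va in auto)
    next
      case False
      then show ?thesis using linkedD[OF conn old, of d d0] d0 that by (auto simp: D'_def)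
    qed
    then show "W (vtx d) = W (vtx e)" using de by simp
  qed
  ultimately show ?case
    by (intro exI[of _ D'] exI[of _ K'] exI[of _ h'] conjI ballI)
qed

text \<open>Turning around the vertex to the next side maps the finitely many corners at
  \<open>v\<close> injectively to themselves, so it permutes them.\<close>

lemma sum_corners_shift:
  fixes \<phi> :: "'f \<times> 3 \<Rightarrow> 'a::comm_monoid_add"
  shows "(\<Sum>d | fst d \<in> F \<and> vtx d = v. \<phi> (next_side (g d))) = (\<Sum>d | fst d \<in> F \<and> vtx d = v. \<phi> d)"
proof (rule sum.reindex_bij_betw)
  let ?C = "{d. fst d \<in> F \<and> vtx d = v}"
  have "finite ?C"
    by (rule finite_subset[OF _ finite_sides[OF finite_faces]]) auto
  moreover have "inj_on (\<lambda>d. next_side (g d)) ?C"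
    by (auto intro!: inj_onI dest: glue_inj)
  moreover have "(\<lambda>d. next_side (g d)) ` ?C \<subseteq> ?C"
    using vtx_next_glue by auto
  ultimately show "bij_betw (\<lambda>d. next_side (g d)) ?C ?C"
    by (simp add: bij_betw_def endo_inj_surj)
qed

text \<open>
  The sides outside a spanning tree of the dual graph form, by Euler's formula, a spanning tree of
  the graph of vertices and edges. The edges where the potential fails lie in this tree, but no
  vertex is the end of exactly one of them, since the failures around a vertex add up to zero.
\<close>

theorem cocycle_is_coboundary:
  fixes c :: "'f \<times> 3 \<Rightarrow> 'a::ab_group_add"
  assumes c: "\<And>d. fst d \<in> F \<Longrightarrow> c (g d) = - c d"
    and c_vtx: "\<And>v. (\<Sum>d | fst d \<in> F \<and> vtx d = v. c d) = 0"
  shows "\<exists>h. \<forall>d. fst d \<in> F \<longrightarrow> h (fst (g d)) = h (fst d) + c d"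
proof -
  have "F \<noteq> {}" using euler by (auto simp: sides_def)
  then have "1 \<le> card F" using finite_faces by (simp add: Suc_leI card_gt_0_iff)
  from spanning_tree[of c "card F", OF c this order_refl]
  obtain D K h where DK: "D \<subseteq> F" "card D = card F" "K \<subseteq> sides D" "g ` K \<subseteq> K" "card K = 2 * (card F - 1)"
    and h: "\<forall>d\<in>K. h (fst (g d)) = h (fst d) + c d"
    and conn: "linked D K"
    by blast
  have DF: "D = F" using DK finite_faces by (simp add: card_subset_eq)
  define R where "R = sides F - K"
  define B where "B = {d \<in> sides F. h (fst (g d)) \<noteq> h (fst d) + c d}"
  define V where "V = vtx ` sides F"
  have finS: "finite (sides F)" using finite_faces by simp
  have "R \<subseteq> sides F" "B \<subseteq> sides F" "K \<subseteq> sides F" using DK(3) DF by (auto simp: R_def B_def)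
  then have fin: "finite R" "finite B" "finite V" "finite K"
    using finS by (simp_all add: V_def finite_subset)
  have KF: "K \<subseteq> sides F" using DK DF by simp
  have gK: "g d \<in> K" if "d \<in> K" for d using DK that by auto
  have gR: "g d \<in> R" if "d \<in> R" for d
    using that gK[of "g d"] by (auto simp: R_def)
  have BR: "B \<subseteq> R" using h by (auto simp: B_def R_def)
  have gB: "g d \<in> B" if "d \<in> B" for d
  proof -
    have "fst d \<in> F" "h (fst (g d)) \<noteq> h (fst d) + c d" using that by (auto simp: B_def)
    then show ?thesis using c[of d] by (simp add: B_def) (metis add_diff_cancel diff_conv_add_uminus)
  qed
  \<comment> \<open>With \<open>n = card F\<close>, there remain
    \<open>3 n - 2 (n - 1) = n + 2\<close> sides; by Euler's formula these are
    \<open>card V - 1\<close> edges.\<close>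
  have cardR: "card R = 2 * card V - 2"
    using KF fin DK euler \<open>1 \<le> card F\<close>
    by (simp add: R_def card_Diff_subset card_sides V_def)
  have cardV: "card V \<ge> 2" using euler by (simp add: V_def)
  have "B = {}"
  proof (rule ccontr)
    assume "B \<noteq> {}"
    have two: "card {d\<in>B. vtx d = v} \<ge> 2" if v: "v \<in> vtx ` B" for v
    proof (rule ccontr)
      let ?C = "{d. fst d \<in> F \<and> vtx d = v}"
      assume "\<not> ?thesis"
      moreover have "card {d\<in>B. vtx d = v} > 0"
        using v fin by (auto simp: card_gt_0_iff)
      ultimately have "card {d\<in>B. vtx d = v} = 1" by linarith
      then obtain e where e: "{d\<in>B. vtx d = v} = {e}" by (rule card_1_singletonE)
      have finC: "finite ?C" by (rule finite_subset[OF _ finS]) auto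
      have "(\<Sum>d\<in>?C. h (fst (g d)) - h (fst d) - c d) = 0"
        using sum_corners_shift[of "\<lambda>d. h (fst d)" v] c_vtx[of v] by (simp add: sum_subtractf)
      moreover have "(\<Sum>d\<in>?C. h (fst (g d)) - h (fst d) - c d) = (\<Sum>d\<in>{e}. h (fst (g d)) - h (fst d) - c d)"
      proof (rule sum.mono_neutral_right[OF finC])
        show "{e} \<subseteq> ?C" using e unfolding B_def by auto
        show "\<forall>d\<in>?C - {e}. h (fst (g d)) - h (fst d) - c d = 0"
        proof
          fix d assume d: "d \<in> ?C - {e}"
          then have "d \<notin> B" using e by blast
          then have "h (fst (g d)) = h (fst d) + c d" using d by (simp add: B_def)
          then show "h (fst (g d)) - h (fst d) - c d = 0" by simp
        qed
      qed
      moreover have "h (fst (g e)) \<noteq> h (fst e) + c e" using e unfolding B_def by blast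
      ultimately show False by (simp add: diff_diff_eq)
    qed
    \<comment> \<open>A good set contains all ends of failing sides and spans at least as many edges
      of \<open>R\<close> as it has vertices. A largest good set is all of \<open>V\<close>, for
      which \<open>R\<close> has one edge too few.\<close>
    define inside where "inside W = {d\<in>R. vtx d \<in> W \<and> vtx (next_side d) \<in> W}" for W
    define good where "good W \<longleftrightarrow> W \<subseteq> V \<and> vtx ` B \<subseteq> W \<and> 2 * card W \<le> card (inside W)" for W
    have "good (vtx ` B)"
    proof -
      have "2 * card (vtx ` B) = (\<Sum>v\<in>vtx ` B. 2)" by simp
      also have "\<dots> \<le> (\<Sum>v\<in>vtx ` B. card {d\<in>B. vtx d = v})"
        by (intro sum_mono two)
      also have "\<dots> = card B"
        using sum.image_gen[OF fin(2), of "\<lambda>_. 1::nat" vtx] by simp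
      also have "\<dots> \<le> card (inside (vtx ` B))"
      proof (rule card_mono)
        show "B \<subseteq> inside (vtx ` B)"
        proof
          fix d assume "d \<in> B"
          then have "vtx (next_side d) = vtx (g d)" by (simp add: B_def vtx_glue)
          then show "d \<in> inside (vtx ` B)" using \<open>d \<in> B\<close> BR gB by (auto simp: inside_def)
        qed
      qed (simp add: inside_def fin)
      finally show ?thesis using BR by (auto simp: good_def V_def R_def)
    qed
    moreover have "card W < Suc (card V)" if "good W" for W
      using that fin by (auto simp: good_def less_Suc_eq_le intro: card_mono)
    ultimately obtain W where W: "good W" and max: "\<forall>W'. good W' \<longrightarrow> card W' \<le> card W"
      using Lattices_Big.ex_has_greatest_nat[of good "vtx ` B" card "Suc (card V)"] by metis
    have WV: "W \<subseteq> V" and BW: "vtx ` B \<subseteq> W" using W by (simp_all add: good_def)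
    have finW: "finite W" using WV fin(3) by (rule finite_subset)
    have "W = V"
    proof (rule ccontr)
      assume "W \<noteq> V"
      \<comment> \<open>By connectedness some edge of \<open>R\<close> leaves \<open>W\<close>.
        Adding its far end gains one vertex and at least one edge, against maximality.\<close>
      have "\<exists>d\<in>R. (vtx d \<in> W) \<noteq> (vtx (next_side d) \<in> W)"
      proof (rule ccontr)
        assume none: "\<not> ?thesis"
        have "(vtx d \<in> W) = (vtx (next_side d) \<in> W)" if "fst d \<in> D" "d \<notin> K" for d
        proof -
          have "d \<in> R" using that DF by (simp add: R_def)
          then show ?thesis using none by blast
        qed
        from linkedD[OF conn, of "\<lambda>v. v \<in> W", OF this]
        have linkF: "(vtx d \<in> W) = (vtx e \<in> W)" if "fst d \<in> F" "fst e \<in> F" for d e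
          using that DF by blast
        obtain b where b: "b \<in> B" using \<open>B \<noteq> {}\<close> by blast
        then have "fst b \<in> F" "vtx b \<in> W" using BW by (auto simp: B_def)
        then have "vtx d \<in> W" if "fst d \<in> F" for d
          using linkF[OF that, of b] by simp
        then have "V \<subseteq> W" unfolding V_def by auto
        then show False using WV \<open>W \<noteq> V\<close> by blast
      qed
      then obtain d where d: "d \<in> R" "vtx d \<in> W" "vtx (next_side d) \<notin> W"
      proof (elim bexE)
        fix d assume d: "d \<in> R" "(vtx d \<in> W) \<noteq> (vtx (next_side d) \<in> W)"
        then have "vtx (g d) = vtx (next_side d)" "vtx (next_side (g d)) = vtx d"
          by (auto simp: R_def vtx_glue vtx_next_glue)
        then show thesis using that[of d] that[of "g d"] d gR[OF d(1)] by (cases "vtx d \<in> W") simp_all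
      qed
      then have dF: "fst d \<in> F" by (simp add: R_def)
      let ?W = "insert (vtx (next_side d)) W"
      have "insert d (insert (g d) (inside W)) \<subseteq> inside ?W"
        using d dF gR by (auto simp: inside_def vtx_glue vtx_next_glue)
      then have "card (insert d (insert (g d) (inside W))) \<le> card (inside ?W)"
        by (rule card_mono[rotated]) (simp add: inside_def fin)
      moreover have "d \<notin> inside W" "g d \<notin> inside W" "finite (inside W)"
        using d dF by (auto simp: inside_def vtx_glue fin)
      ultimately have "card (inside ?W) \<ge> card (inside W) + 2"
        using glue_neq[OF dF, symmetric] by simp
      moreover have "vtx (next_side d) \<in> V" unfolding V_def using dF by auto
      ultimately have "good ?W" using W d finW by (auto simp: good_def)
      from max[rule_format, OF this] show False using d finW by simp
    qed
    then have "2 * card V \<le> card (inside V)" using W by (simp add: good_def)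
    also have "\<dots> \<le> card R" by (rule card_mono) (auto simp: fin inside_def)
    finally show False using cardR cardV by simp
  qed
  then have "\<forall>d. fst d \<in> F \<longrightarrow> h (fst (g d)) = h (fst d) + c d" by (auto simp: B_def)
  then show ?thesis by (intro exI[of _ h])
qed

end

section \<open>The isoperimetric inequality\<close>

text \<open>
  The triangles of the plane lattice are the integer triples \<open>p\<close> with coordinate sum \<open>0\<close> (pointing
  up) or \<open>- 1\<close> (pointing down): \<open>p k\<close> is the number of the strip containing the triangle among the
  strips parallel to the direction \<open>k\<close>. So crossing a side in the direction \<open>k\<close> changes \<open>p k\<close> only,
  and crossing sides in the other two directions alternately runs along a strip.
\<close>

definition cross :: "(3 \<Rightarrow> int) \<Rightarrow> 3 \<Rightarrow> 3 \<Rightarrow> int" where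
  "cross p k = p(k := p k + (if sum p UNIV = 0 then - 1 else 1))"

text \<open>Position within a strip, increasing in the sense chosen by \<open>b\<close>; crossing
  the side in the direction \<open>ahead\<close> advances it by one.\<close>

definition along :: "bool \<Rightarrow> 3 \<Rightarrow> (3 \<Rightarrow> int) \<Rightarrow> int" where
  "along b k p = (if b then p (k + 1) - p (k + 2) else p (k + 2) - p (k + 1))"

definition ahead :: "bool \<Rightarrow> 3 \<Rightarrow> (3 \<Rightarrow> int) \<Rightarrow> 3" where
  "ahead b k p = (if (sum p UNIV = 0) = b then k + 2 else k + 1)"

lemma add_1_neq_3 [simp]: "k + 1 \<noteq> k" "k + 2 \<noteq> k" "k + 1 \<noteq> k + 2" "k + 2 \<noteq> k + (1::3)"
  by simp_all

lemma ahead_neq: "ahead b k p \<noteq> k"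
  by (simp add: ahead_def)

lemma ahead_neq_ahead: "ahead True k p \<noteq> ahead False k p" "ahead False k p \<noteq> ahead True k p"
  by (simp_all add: ahead_def)

lemma cross_ahead_row: "cross p (ahead b k p) k = p k"
  using ahead_neq[of b k p] by (simp add: cross_def)

lemma along_cross_ahead: "along b k (cross p (ahead b k p)) = along b k p + 1"
  by (simp add: along_def ahead_def cross_def)

lemma sum_squares_le_square_sum:
  fixes f :: "'a \<Rightarrow> nat"
  assumes "finite A"
  shows "(\<Sum>a\<in>A. (f a)\<^sup>2) \<le> (\<Sum>a\<in>A. f a)\<^sup>2"
proof -
  have "(\<Sum>a\<in>A. (f a)\<^sup>2) \<le> (\<Sum>a\<in>A. f a * (\<Sum>a\<in>A. f a))"
    using assms by (intro sum_mono) (auto simp: power2_eq_square intro: member_le_sum)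
  then show ?thesis by (simp add: power2_eq_square sum_distrib_right)
qed

text \<open>The faces of one color as lattice triangles with multiplicity. The gluing is constrained
  only between faces of the class; sides leading out of it are its boundary.\<close>

locale color_class =
  fixes B :: "'f set" and g :: "'f \<times> 3 \<Rightarrow> 'f \<times> 3" and m :: "'f \<times> 3 \<Rightarrow> 3"
    and P :: "'f \<Rightarrow> 3 \<Rightarrow> int"
  assumes finite_class: "finite B"
    and glue_inside: "fst d \<in> B \<Longrightarrow> fst (g d) \<in> B \<Longrightarrow> g (g d) = d \<and> m (g d) = m d"
    and cross_inside: "fst d \<in> B \<Longrightarrow> fst (g d) \<in> B \<Longrightarrow> P (fst (g d)) = cross (P (fst d)) (m d)"
    and cell: "t \<in> B \<Longrightarrow> sum (P t) UNIV \<in> {0, - 1}"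
    and directions: "t \<in> B \<Longrightarrow> bij (\<lambda>i. m (t, i))"
begin

definition folds :: "('f \<times> 3) set" where
  "folds = {d \<in> sides B. fst (g d) \<notin> B}"

definition multiplicity :: "(3 \<Rightarrow> int) \<Rightarrow> nat" where
  "multiplicity p = card {t \<in> B. P t = p}"

lemma finite_folds: "finite folds"
  using finite_class by (auto simp: folds_def intro: finite_subset[OF _ finite_sides])

lemma side_unique:
  assumes "fst d \<in> B" "fst d = fst e" "m d = m e"
  shows "d = e"
proof -
  have "inj (\<lambda>i. m (fst d, i))" using directions assms by (simp add: bij_is_inj)
  moreover have "m (fst d, snd d) = m (fst d, snd e)" using assms by (metis prod.collapse)
  ultimately have "snd d = snd e" by (rule injD)
  then show ?thesis using assms by (simp add: prod_eq_iff)
qed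

text \<open>A face over \<open>p\<close> has exactly one side in the direction \<open>k\<close>.
  That side is a fold or leads to a face over \<open>cross p k\<close>, which in turn determines
  it.\<close>

lemma multiplicity_cross:
  "multiplicity p \<le> card {d \<in> folds. P (fst d) = p \<and> m d = k} + multiplicity (cross p k)"
proof -
  let ?S = "{d \<in> sides B. P (fst d) = p \<and> m d = k}"
  let ?I = "{d \<in> ?S. fst (g d) \<in> B}"
  have finS: "finite ?S"
    by (rule finite_subset[OF _ finite_sides[OF finite_class]]) auto
  have "{t \<in> B. P t = p} \<subseteq> fst ` ?S"
  proof
    fix t assume t: "t \<in> {t \<in> B. P t = p}"
    then have "surj (\<lambda>i. m (t, i))" using directions by (simp add: bij_is_surj)
    then obtain i where "k = m (t, i)" by (rule surjE)
    then show "t \<in> fst ` ?S" using t by (intro image_eqI[of _ _ "(t, i)"]) auto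
  qed
  then have "multiplicity p \<le> card (fst ` ?S)"
    unfolding multiplicity_def using finS by (intro card_mono finite_imageI)
  also have "\<dots> \<le> card ?S" using finS by (rule card_image_le)
  also have "?S = {d \<in> folds. P (fst d) = p \<and> m d = k} \<union> ?I" by (auto simp: folds_def)
  also have "card \<dots> \<le> card {d \<in> folds. P (fst d) = p \<and> m d = k} + card ?I" by (rule card_Un_le)
  also have "card ?I \<le> multiplicity (cross p k)"
    unfolding multiplicity_def
  proof (rule card_inj_on_le)
    show "inj_on (\<lambda>d. fst (g d)) ?I"
    proof (rule inj_onI)
      fix d e assume de: "d \<in> ?I" "e \<in> ?I" "fst (g d) = fst (g e)"
      then have "m (g d) = m d" "m (g e) = m e" "g (g d) = d" "g (g e) = e"
        using glue_inside by auto
      then have "g d = g e" using side_unique[of "g d" "g e"] de by simp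
      then show "d = e" using \<open>g (g d) = d\<close> \<open>g (g e) = e\<close> by metis
    qed
    show "(\<lambda>d. fst (g d)) ` ?I \<subseteq> {t \<in> B. P t = cross p k}"
      using cross_inside by auto
  qed (use finite_class in simp)
  finally show ?thesis by simp
qed

text \<open>Along the strip, each step lowers the multiplicity by at most the number of folds met
  there, and beyond the finitely many faces it is zero.\<close>

lemma multiplicity_ray:
  "multiplicity p \<le> card {d \<in> folds. P (fst d) k = p k \<and> along b k p \<le> along b k (P (fst d)) \<and> m d = ahead b k (P (fst d))}"
proof -
  let ?R = "\<lambda>p. {d \<in> folds. P (fst d) k = p k \<and> along b k p \<le> along b k (P (fst d)) \<and> m d = ahead b k (P (fst d))}"
  obtain M where M: "\<And>t. t \<in> B \<Longrightarrow> along b k (P t) < M"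
  proof
    show "along b k (P t) < Max ((\<lambda>t. along b k (P t)) ` B) + 1" if "t \<in> B" for t
      using Max_ge[of "(\<lambda>t. along b k (P t)) ` B" "along b k (P t)"] that finite_class by simp
  qed
  have "multiplicity p \<le> card (?R p)" if "M \<le> along b k p + int n" for n p
    using that
  proof (induction n arbitrary: p)
    case 0
    then have "{t \<in> B. P t = p} = {}" using M by fastforce
    then show ?case by (simp only: multiplicity_def card.empty)
  next
    case (Suc n)
    let ?p = "cross p (ahead b k p)"
    let ?G = "{d \<in> folds. P (fst d) = p \<and> m d = ahead b k p}"
    have "multiplicity ?p \<le> card (?R ?p)"
      by (rule Suc.IH) (use Suc.prems in \<open>simp add: along_cross_ahead\<close>)
    then have "multiplicity p \<le> card ?G + card (?R ?p)"
      using multiplicity_cross[of p "ahead b k p"] by linarith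
    also have "\<dots> = card (?G \<union> ?R ?p)"
      by (rule card_Un_disjoint[symmetric]) (auto simp: finite_folds along_cross_ahead)
    also have "\<dots> \<le> card (?R p)"
      by (rule card_mono) (auto simp: finite_folds along_cross_ahead cross_ahead_row)
    finally show ?case .
  qed
  from this[of p "nat (M - along b k p)"] show ?thesis by simp
qed

text \<open>The rays in both senses each have to use up the multiplicity. They share no fold, since
  they leave a cell through different sides, neither in the direction \<open>k\<close>.\<close>

lemma multiplicity_row:
  "2 * multiplicity p \<le> card {d \<in> folds. m d \<noteq> k \<and> P (fst d) k = p k}"
proof -
  let ?R = "\<lambda>b. {d \<in> folds. P (fst d) k = p k \<and> along b k p \<le> along b k (P (fst d)) \<and> m d = ahead b k (P (fst d))}"
  have "2 * multiplicity p \<le> card (?R True) + card (?R False)"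
    using multiplicity_ray[of p k True] multiplicity_ray[of p k False] by linarith
  also have "\<dots> = card (?R True \<union> ?R False)"
    by (rule card_Un_disjoint[symmetric]) (auto simp: finite_folds ahead_neq_ahead)
  also have "\<dots> \<le> card {d \<in> folds. m d \<noteq> k \<and> P (fst d) k = p k}"
    by (rule card_mono) (auto simp: finite_folds ahead_neq ahead_neq[symmetric])
  finally show ?thesis .
qed

text \<open>Projection of a superlevel set of the multiplicity to the strips parallel to
  \<open>k\<close>.\<close>

definition shadow :: "3 \<Rightarrow> nat \<Rightarrow> int set" where
  "shadow k j = {r. \<exists>t\<in>B. P t k = r \<and> j \<le> multiplicity (P t)}"

lemma finite_shadow: "finite (shadow k j)"
proof (rule finite_subset)
  show "shadow k j \<subseteq> (\<lambda>t. P t k) ` B" by (auto simp: shadow_def)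
qed (use finite_class in simp)

text \<open>A strip lies in the shadows of at most as many levels as its largest multiplicity, which
  is at most half the number of its folds in other directions.\<close>

lemma sum_shadow: "2 * (\<Sum>j=1..J. card (shadow k j)) \<le> card {d \<in> folds. m d \<noteq> k}"
proof -
  let ?r = "\<lambda>t. P t k"
  let ?c = "\<lambda>r. card {d \<in> folds. m d \<noteq> k \<and> P (fst d) k = r}"
  have "(\<Sum>j=1..J. card (shadow k j)) = (\<Sum>j=1..J. card {r \<in> ?r ` B. r \<in> shadow k j})"
    by (intro sum.cong refl arg_cong[of _ _ card]) (auto simp: shadow_def)
  also have "\<dots> = (\<Sum>r\<in>?r ` B. card {j \<in> {1..J}. r \<in> shadow k j})"
    by (rule sum_multicount_gen) (auto simp: finite_class)
  also have "\<dots> \<le> (\<Sum>r\<in>?r ` B. ?c r div 2)"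
  proof (rule sum_mono)
    fix r
    have "{j \<in> {1..J}. r \<in> shadow k j} \<subseteq> {1..?c r div 2}"
    proof
      fix j assume "j \<in> {j \<in> {1..J}. r \<in> shadow k j}"
      then obtain t where "1 \<le> j" "P t k = r" "j \<le> multiplicity (P t)" by (auto simp: shadow_def)
      then show "j \<in> {1..?c r div 2}" using multiplicity_row[of "P t" k] by auto
    qed
    from card_mono[OF _ this] show "card {j \<in> {1..J}. r \<in> shadow k j} \<le> ?c r div 2" by simp
  qed
  finally have "2 * (\<Sum>j=1..J. card (shadow k j)) \<le> (\<Sum>r\<in>?r ` B. 2 * (?c r div 2))"
    unfolding sum_distrib_left[symmetric] by simp
  also have "\<dots> \<le> (\<Sum>r\<in>?r ` B. ?c r)" by (intro sum_mono) simp
  also have "\<dots> = card {d \<in> folds. m d \<noteq> k}"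
  proof -
    have "(\<Sum>r\<in>?r ` B. \<Sum>d | d \<in> {d \<in> folds. m d \<noteq> k} \<and> P (fst d) k = r. 1::nat) = (\<Sum>d\<in>{d \<in> folds. m d \<noteq> k}. 1)"
      by (rule sum.group, simp add: finite_folds, simp add: finite_class, auto simp: folds_def)
    then show ?thesis by (simp add: conj_assoc)
  qed
  finally show ?thesis .
qed

text \<open>A cell is determined by its three strip numbers, so the level set embeds into the
  triples of \<open>hexagonal_triple_count\<close>.\<close>

lemma card_level:
  "6 * card {p \<in> P ` B. j \<le> multiplicity p} \<le> (\<Sum>k\<in>UNIV. card (shadow k j))\<^sup>2"
proof -
  let ?T = "{(a, b, c). a \<in> shadow 1 j \<and> b \<in> shadow 2 j \<and> c \<in> shadow 3 j \<and> a + b + c \<in> {0, - 1}}"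
  have "card {p \<in> P ` B. j \<le> multiplicity p} \<le> card ?T"
  proof (rule card_inj_on_le)
    show "inj_on (\<lambda>p. (p 1, p 2, p 3)) {p \<in> P ` B. j \<le> multiplicity p}"
      by (rule inj_onI) (simp add: fun_eq_iff forall_3)
    show "(\<lambda>p. (p 1, p 2, p 3)) ` {p \<in> P ` B. j \<le> multiplicity p} \<subseteq> ?T"
      using cell by (auto simp: shadow_def sum_3 simp del: three_eq_0)
    show "finite ?T"
      by (rule finite_subset[of _ "shadow 1 j \<times> shadow 2 j \<times> shadow 3 j"]) (auto simp: finite_shadow)
  qed
  then have "6 * card {p \<in> P ` B. j \<le> multiplicity p} \<le> 6 * card ?T" by simp
  also have "\<dots> \<le> (card (shadow 1 j) + card (shadow 2 j) + card (shadow 3 j))\<^sup>2"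
    by (rule hexagonal_triple_count) (rule finite_shadow)+
  finally show ?thesis by (simp add: sum_3 del: three_eq_0)
qed

text \<open>Layer-cake summation: \<open>card B\<close> is the sum of the sizes of the level sets,
  and the squares bounding them are merged into one.\<close>

theorem isoperimetry: "6 * card B \<le> (card folds)\<^sup>2"
proof -
  let ?J = "card B"
  have "(\<Sum>p\<in>P ` B. multiplicity p) = card B"
    using sum.image_gen[OF finite_class, of "\<lambda>_. 1::nat" P] by (simp add: multiplicity_def)
  moreover have "(\<Sum>j=1..?J. card {p \<in> P ` B. j \<le> multiplicity p}) = (\<Sum>p\<in>P ` B. multiplicity p)"
  proof (rule sum_multicount_gen)
    have "{j \<in> {1..?J}. j \<le> multiplicity p} = {1..multiplicity p}" for p
      using card_mono[OF finite_class, of "{t \<in> B. P t = p}"] by (auto simp: multiplicity_def)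
    then show "\<forall>p\<in>P ` B. card {j \<in> {1..?J}. j \<le> multiplicity p} = multiplicity p" by simp
  qed (use finite_class in auto)
  ultimately have "6 * card B = (\<Sum>j=1..?J. 6 * card {p \<in> P ` B. j \<le> multiplicity p})"
    by (simp flip: sum_distrib_left)
  also have "\<dots> \<le> (\<Sum>j=1..?J. (\<Sum>k\<in>UNIV. card (shadow k j))\<^sup>2)"
    by (intro sum_mono card_level)
  also have "\<dots> \<le> (\<Sum>j=1..?J. \<Sum>k\<in>UNIV. card (shadow k j))\<^sup>2"
    by (rule sum_squares_le_square_sum) simp
  also have "\<dots> \<le> (card folds)\<^sup>2"
  proof (rule power_mono)
    have "2 * (\<Sum>j=1..?J. \<Sum>k\<in>UNIV. card (shadow k j)) = (\<Sum>k\<in>UNIV. 2 * (\<Sum>j=1..?J. card (shadow k j)))"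
      by (subst sum.swap) (simp add: sum_distrib_left)
    also have "\<dots> \<le> (\<Sum>k\<in>UNIV. card {d \<in> folds. m d \<noteq> k})"
      by (intro sum_mono sum_shadow)
    \<comment> \<open>Each fold counts for the two directions other than its own.\<close>
    also have "\<dots> = (\<Sum>d\<in>folds. 2)"
    proof (rule sum_multicount_gen)
      have "{k \<in> UNIV. x \<noteq> k} = UNIV - {x}" for x :: 3 by auto
      then show "\<forall>d\<in>folds. card {k \<in> UNIV. m d \<noteq> k} = 2" by (simp add: card_Diff_subset)
    qed (auto simp: finite_folds)
    finally show "(\<Sum>j=1..?J. \<Sum>k\<in>UNIV. card (shadow k j)) \<le> card folds" by simp
  qed simp
  finally show ?thesis .
qed

end

section \<open>The folding map\<close>

lemma two_eq_0: "(2::2) = 0"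
  by simp

lemma add_1_twice: "x + 1 + 1 = x - (1::3)"
  using exhaust_3[of x] by auto

lemma diff_1_twice: "x - 1 - 1 = x + (1::3)"
  using exhaust_3[of x] by auto

lemma directions_partition:
  fixes x k :: 3
  shows "of_bool (x = k) + of_bool (x + 1 = k) + of_bool (x - 1 = k) = (1 :: int)"
  using exhaust_3[of x] exhaust_3[of k] by (elim disjE) simp_all

locale balanced_coloring = euler_gluing F g vtx
  for F :: "'f set" and g :: "'f \<times> 3 \<Rightarrow> 'f \<times> 3" and vtx :: "'f \<times> 3 \<Rightarrow> 'v" +
  fixes black :: "'f \<Rightarrow> bool"
  assumes balanced: "(\<Sum>d | fst d \<in> F \<and> vtx d = v. if black (fst d) then 1 else - 1 :: 3) = 0"
    and even_degree: "even (card {d. fst d \<in> F \<and> vtx d = v})"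
begin

text \<open>Directions run forward around black faces and backward around white ones, leaving one
  free constant per face. Matching these across edges is a cocycle problem modulo 3.\<close>

lemma edge_directions:
  obtains m :: "'f \<times> 3 \<Rightarrow> 3" where "\<And>d. fst d \<in> F \<Longrightarrow> m (g d) = m d"
    "\<And>d. m (next_side d) = m d + (if black (fst d) then 1 else - 1)"
proof -
  define sg where "sg t = (if black t then 1 else - 1 :: 3)" for t
  define A where "A d = sg (fst d) * snd d" for d :: "'f \<times> 3"
  have A_next: "A (next_side d) = A d + sg (fst d)" for d
    by (simp add: A_def algebra_simps)
  have "\<exists>\<theta>. \<forall>d. fst d \<in> F \<longrightarrow> \<theta> (fst (g d)) = \<theta> (fst d) + (A d - A (g d))"
  proof (rule cocycle_is_coboundary)
    show "A (g d) - A (g (g d)) = - (A d - A (g d))" if "fst d \<in> F" for d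
      using that by simp
    show "(\<Sum>d | fst d \<in> F \<and> vtx d = v. A d - A (g d)) = 0" for v
    proof -
      \<comment> \<open>Expressed by corners at the same vertex, the \<open>A\<close> terms cancel
        by rotation; the signs remain and add up to zero by \<open>balanced\<close>.\<close>
      have "A d - A (g d) = A d - A (next_side (g d)) + sg (fst (next_side (g d)))" for d
        by (simp add: A_next)
      then show ?thesis
        using balanced[of v] sum_corners_shift[of A v] sum_corners_shift[of "\<lambda>d. sg (fst d)" v]
        by (simp only: sum.distrib sum_subtractf) (simp add: sg_def)
    qed
  qed
  then obtain \<theta> where \<theta>: "\<forall>d. fst d \<in> F \<longrightarrow> \<theta> (fst (g d)) = \<theta> (fst d) + (A d - A (g d))" ..
  show thesis
  proof (rule that[of "\<lambda>d. \<theta> (fst d) + A d"])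
    show "\<theta> (fst (g d)) + A (g d) = \<theta> (fst d) + A d" if "fst d \<in> F" for d
      using \<theta>[rule_format, OF that] by simp
    show "\<theta> (fst (next_side d)) + A (next_side d) = \<theta> (fst d) + A d + (if black (fst d) then 1 else - 1)" for d
      by (simp add: A_next add.assoc) (simp add: sg_def)
  qed
qed

text \<open>Around a vertex the constant cocycle 1 modulo 2 adds up to the degree, which is
  even.\<close>

lemma face_parity:
  obtains \<nu> :: "'f \<Rightarrow> bool" where "\<And>d. fst d \<in> F \<Longrightarrow> \<nu> (fst (g d)) = (\<not> \<nu> (fst d))"
proof -
  have "\<exists>h. \<forall>d. fst d \<in> F \<longrightarrow> h (fst (g d)) = h (fst d) + (1 :: 2)"
  proof (rule cocycle_is_coboundary[of "\<lambda>_. 1"])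
    fix v
    obtain n where "card {d. fst d \<in> F \<and> vtx d = v} = 2 * n" using even_degree by (rule evenE)
    then show "(\<Sum>d | fst d \<in> F \<and> vtx d = v. 1 :: 2) = 0" by (simp add: two_eq_0)
  qed simp
  then obtain h where h: "\<forall>d. fst d \<in> F \<longrightarrow> h (fst (g d)) = h (fst d) + (1 :: 2)" ..
  show thesis
  proof (rule that[of "\<lambda>t. h t = 0"])
    fix d :: "'f \<times> 3" assume "fst d \<in> F"
    from h[rule_format, OF this] show "(h (fst (g d)) = 0) = (\<not> h (fst d) = 0)"
      using exhaust_2[of "h (fst d)"] by auto
  qed
qed

lemma face_invariant_const:
  assumes "\<And>d. fst d \<in> F \<Longrightarrow> S (fst (g d)) = S (fst d)" "t \<in> F" "t' \<in> F"
  shows "S t = S t'"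
proof (rule ccontr)
  assume "S t \<noteq> S t'"
  then have "t' \<notin> {s \<in> F. S s = S t}" by simp
  then have "\<exists>d\<in>sides {s \<in> F. S s = S t}. fst (g d) \<notin> {s \<in> F. S s = S t}"
    using assms(2,3) by (intro dual_connected) blast+
  then obtain d where "fst d \<in> F" "S (fst d) = S t" "fst (g d) \<notin> {s \<in> F. S s = S t}" by auto
  then show False using assms(1)[of d] by simp
qed

text \<open>
  The corner of a cell \<open>p\<close> opposite to its side in the direction \<open>k\<close> is \<open>p\<close> plus the \<open>k\<close>-th unit
  vector if the coordinates of \<open>p\<close> add up to \<open>0\<close>, and \<open>p + (1, 1, 1)\<close> minus that vector otherwise.
  Neighbouring faces have to be placed so that their common corners agree, hence the displacement
  of the cells is a difference of corner offsets and adds up to zero around every vertex.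
\<close>

lemma folding_map:
  obtains m :: "'f \<times> 3 \<Rightarrow> 3" and P :: "'f \<Rightarrow> 3 \<Rightarrow> int" where
    "\<And>d. fst d \<in> F \<Longrightarrow> m (g d) = m d"
    "\<And>t. bij (\<lambda>i. m (t, i))"
    "\<And>t. t \<in> F \<Longrightarrow> sum (P t) UNIV \<in> {0, - 1}"
    "\<And>d. \<lbrakk>fst d \<in> F; black (fst (g d)) = black (fst d)\<rbrakk> \<Longrightarrow> P (fst (g d)) = cross (P (fst d)) (m d)"
proof -
  obtain m :: "'f \<times> 3 \<Rightarrow> 3" where m_glue: "\<And>d. fst d \<in> F \<Longrightarrow> m (g d) = m d"
    and m_next: "\<And>d. m (next_side d) = m d + (if black (fst d) then 1 else - 1)"
    using edge_directions by blast
  obtain \<nu> where \<nu>: "\<And>d. fst d \<in> F \<Longrightarrow> \<nu> (fst (g d)) = (\<not> \<nu> (fst d))"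
    using face_parity by blast
  \<comment> \<open>A fold reflects a face onto its neighbour's cell, while any other edge separates
    an upward from a downward triangle. Comparing the alternating parity with the color has this
    effect.\<close>
  define up where "up t \<longleftrightarrow> \<nu> t = black t" for t
  have up_glue: "up (fst (g d)) = (if black (fst (g d)) = black (fst d) then \<not> up (fst d) else up (fst d))"
    if "fst d \<in> F" for d
    using \<nu>[OF that] by (auto simp: up_def)
  \<comment> \<open>\<open>next_side d\<close> is opposite to the corner \<open>d\<close>, so this
    is coordinate \<open>k\<close> of that corner relative to the cell.\<close>
  define off where "off k d = (if up (fst d) then of_bool (m (next_side d) = k)
     else 1 - of_bool (m (next_side d) = k) :: int)" for k d
  \<comment> \<open>The neighbour's corner at the same vertex is \<open>next_side (g d)\<close>;
    this displacement makes both corners coincide.\<close>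
  define c where "c k d = off k d - off k (next_side (g d))" for k d
  have c_eq: "c k d = (if black (fst (g d)) = black (fst d) \<and> m d = k
      then if up (fst d) then - 1 else 1 else 0)" if "fst d \<in> F" for k d
  proof -
    have "m (next_side (next_side (g d))) = (if black (fst (g d)) then m d - 1 else m d + 1)"
      using m_glue[OF that] add_1_twice[of "m d"] diff_1_twice[of "m d"] by (simp add: m_next)
    moreover have "m (next_side d) = (if black (fst d) then m d + 1 else m d - 1)"
      by (simp add: m_next)
    ultimately show ?thesis
      using directions_partition[of "m d" k]
      by (cases "black (fst d)"; cases "black (fst (g d))"; cases "up (fst d)")
        (simp_all add: c_def off_def up_glue[OF that] of_bool_def split: if_splits)
  qed
  have "\<exists>h. \<forall>d. fst d \<in> F \<longrightarrow> h (fst (g d)) = h (fst d) + c k d" for k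
  proof (rule cocycle_is_coboundary[of "c k"])
    show "c k (g d) = - c k d" if "fst d \<in> F" for d
      using that by (simp add: c_eq m_glue up_glue)
    show "(\<Sum>d | fst d \<in> F \<and> vtx d = v. c k d) = 0" for v
      using sum_corners_shift[of "off k" v] by (simp add: c_def sum_subtractf)
  qed
  then obtain H where H: "\<And>k d. fst d \<in> F \<Longrightarrow> H k (fst (g d)) = H k (fst d) + c k d"
    by metis
  \<comment> \<open>The coordinate sums are correct up to a constant common to all faces, which a
    shift of one coordinate removes.\<close>
  define S where "S t = (\<Sum>k\<in>UNIV. H k t) + of_bool (\<not> up t)" for t
  have S_glue: "S (fst (g d)) = S (fst d)" if "fst d \<in> F" for d
  proof -
    have "(\<Sum>k\<in>UNIV. c k d) = (\<Sum>k\<in>UNIV. if m d = k then if black (fst (g d)) = black (fst d)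
        then if up (fst d) then - 1 else 1 else 0 else 0)"
      using that by (intro sum.cong) (auto simp: c_eq)
    then have "(\<Sum>k\<in>UNIV. c k d) = (if black (fst (g d)) = black (fst d)
        then if up (fst d) then - 1 else 1 else 0)"
      by simp
    then show ?thesis using that by (simp add: S_def H sum.distrib up_glue)
  qed
  obtain s where s: "\<And>t. t \<in> F \<Longrightarrow> S t = s"
    using face_invariant_const[of S, OF S_glue] by metis
  define P where "P t k = H k t - (if k = 0 then s else 0)" for t k
  have sumP: "sum (P t) UNIV = - of_bool (\<not> up t)" if "t \<in> F" for t
    using s[OF that] by (simp add: P_def S_def sum_subtractf)
  show thesis
  proof (rule that[of m P])
    show "bij (\<lambda>i. m (t, i))" for t
    proof -
      have step: "m (t, i + 1) = (if black t then m (t, i) + 1 else m (t, i) - 1)" for i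
        using m_next[of "(t, i)"] by (simp add: next_side_def)
      have "m (t, 2) = (if black t then m (t, 1) + 1 else m (t, 1) - 1)"
        "m (t, 3) = (if black t then m (t, 1) - 1 else m (t, 1) + 1)"
        using step[of 1] step[of 2] add_1_twice[of "m (t, 1)"] diff_1_twice[of "m (t, 1)"]
        by (simp_all del: three_eq_0)
      moreover have "x + 1 \<noteq> x - 1" "x - 1 \<noteq> x + 1" "x - 1 \<noteq> x" "x \<noteq> x - 1" "x \<noteq> x + 1" for x :: 3
        using exhaust_3[of x] by auto
      ultimately have "inj (\<lambda>i. m (t, i))"
        unfolding inj_def forall_3 by (cases "black t") simp_all
      then show ?thesis by (simp add: bij_def finite_UNIV_inj_surj)
    qed
    show "P (fst (g d)) = cross (P (fst d)) (m d)"
      if "fst d \<in> F" "black (fst (g d)) = black (fst d)" for d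
    proof
      fix k
      have "sum (P (fst d)) UNIV = 0 \<longleftrightarrow> up (fst d)" using sumP[OF that(1)] by simp
      moreover have "P (fst (g d)) k = P (fst d) k + c k d" using H[OF that(1)] by (simp add: P_def)
      ultimately show "P (fst (g d)) k = cross (P (fst d)) (m d) k"
        using that by (simp add: cross_def c_eq)
    qed
  qed (use m_glue sumP in auto)
qed

text \<open>\<open>color_class\<close> is blind to orientation, so one folding map serves both
  colors.\<close>

lemma color_class_bound:
  "6 * card {t \<in> F. black t = b} \<le> (card {d. fst d \<in> F \<and> black (fst d) = b \<and> black (fst (g d)) \<noteq> b})\<^sup>2"
proof -
  obtain m :: "'f \<times> 3 \<Rightarrow> 3" and P :: "'f \<Rightarrow> 3 \<Rightarrow> int" where mP:
    "\<And>d. fst d \<in> F \<Longrightarrow> m (g d) = m d"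
    "\<And>t. bij (\<lambda>i. m (t, i))"
    "\<And>t. t \<in> F \<Longrightarrow> sum (P t) UNIV \<in> {0, - 1}"
    "\<And>d. \<lbrakk>fst d \<in> F; black (fst (g d)) = black (fst d)\<rbrakk> \<Longrightarrow> P (fst (g d)) = cross (P (fst d)) (m d)"
    using folding_map by blast
  let ?B = "{t \<in> F. black t = b}"
  interpret color_class ?B g m P
  proof
    show "finite ?B" using finite_faces by simp
  qed (use mP in auto)
  have "folds = {d. fst d \<in> F \<and> black (fst d) = b \<and> black (fst (g d)) \<noteq> b}"
    by (auto simp: folds_def)
  then show ?thesis using isoperimetry by simp
qed

end

section \<open>Triangulations of the sphere\<close>

lemma sphere_triangulation_fibre:
  assumes "sphere_triangulation F g q" "x \<in> F \<times> std_triangle" "y \<in> F \<times> std_triangle"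
  shows "q x = q y \<longleftrightarrow> (x, y) \<in> (glue_rel F g)\<^sup>*"
proof -
  have "\<forall>x\<in>F \<times> std_triangle. \<forall>y\<in>F \<times> std_triangle. q x = q y \<longleftrightarrow> (x, y) \<in> (glue_rel F g)\<^sup>*"
    using assms(1) unfolding sphere_triangulation_def by (elim conjE)
  from bspec[OF bspec[OF this assms(2)] assms(3)] show ?thesis .
qed

text \<open>Otherwise the faces in \<open>D\<close> and those outside have saturated, hence open,
  images that disconnect the sphere.\<close>

lemma sphere_triangulation_dual_connected:
  assumes T: "sphere_triangulation F g q" and D: "D \<subseteq> F" "D \<noteq> {}" "D \<noteq> F"
  shows "\<exists>d\<in>sides D. fst (g d) \<notin> D"
proof (rule ccontr)
  assume "\<not> ?thesis"
  then have closed: "fst (g d) \<in> D" if "fst d \<in> D" for d using that by auto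
  have gluing: "side_gluing F g" using T by (simp add: sphere_triangulation_def)
  have glue: "(fst (g d) \<in> D) = (fst d \<in> D)" if "fst d \<in> F" for d
    using closed[of d] closed[of "g d"] gluing that by (auto simp: side_gluing_def)
  let ?X = "prod_topology (discrete_topology F) (top_of_set std_triangle)"
  have quot: "quotient_map ?X (top_of_set (sphere 0 1)) q"
    using T by (simp add: sphere_triangulation_def)
  have "(fst x \<in> D) = (fst y \<in> D)" if "(x, y) \<in> (glue_rel F g)\<^sup>*" for x y
    using that
  proof (induction rule: rtrancl_induct)
    case (step y z)
    then show ?case using glue by (auto simp: glue_rel_def side_point_def)
  qed simp
  then have same: "(fst x \<in> D) = (fst y \<in> D)"
    if "x \<in> F \<times> std_triangle" "y \<in> F \<times> std_triangle" "q x = q y" for x y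
    using sphere_triangulation_fibre[OF T that(1,2)] that(3) by blast
  have q_image: "q ` (F \<times> std_triangle) = sphere 0 1"
    using quotient_imp_surjective_map[OF quot] by simp
  have open_image: "openin (top_of_set (sphere 0 1)) (q ` (E \<times> std_triangle))"
    if E: "E \<subseteq> F" "{x \<in> F \<times> std_triangle. q x \<in> q ` (E \<times> std_triangle)} = E \<times> std_triangle" for E
  proof -
    have "openin ?X (E \<times> std_triangle)" using E by (simp add: openin_prod_Times_iff)
    moreover have "q ` (E \<times> std_triangle) \<subseteq> sphere 0 1" using E q_image by blast
    moreover have "\<forall>U. U \<subseteq> sphere 0 1 \<longrightarrow>
        openin ?X {x \<in> F \<times> std_triangle. q x \<in> U} = openin (top_of_set (sphere 0 1)) U"
      using quot by (simp add: quotient_map_def)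
    ultimately show ?thesis by (metis (no_types) E(2))
  qed
  have sub: "F - D \<subseteq> F" by blast
  have sat: "x \<in> E \<times> std_triangle" if E: "E = D \<or> E = F - D"
    and x: "x \<in> F \<times> std_triangle" "q x \<in> q ` (E \<times> std_triangle)" for E x
  proof -
    obtain y where y: "q x = q y" "y \<in> E \<times> std_triangle" using x(2) by (rule imageE)
    have "E \<subseteq> F" using E D(1) by blast
    then have "y \<in> F \<times> std_triangle" using y(2) by (auto simp: mem_Times_iff)
    from same[OF x(1) this y(1)] have "fst x \<in> E" using E x(1) y(2) by (auto simp: mem_Times_iff)
    then show ?thesis using x(1) by (simp add: mem_Times_iff)
  qed
  have sat_eq: "{x \<in> F \<times> std_triangle. q x \<in> q ` (E \<times> std_triangle)} = E \<times> std_triangle"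
    if E: "E = D \<or> E = F - D" for E
  proof (intro equalityI subsetI)
    fix x assume "x \<in> {x \<in> F \<times> std_triangle. q x \<in> q ` (E \<times> std_triangle)}"
    then show "x \<in> E \<times> std_triangle" by (intro sat[OF E]) simp_all
  next
    fix x assume x: "x \<in> E \<times> std_triangle"
    have "E \<subseteq> F" using E D(1) by blast
    then have "x \<in> F \<times> std_triangle" using x by (auto simp: mem_Times_iff)
    then show "x \<in> {x \<in> F \<times> std_triangle. q x \<in> q ` (E \<times> std_triangle)}"
      using x by (intro CollectI conjI imageI)
  qed
  let ?A = "q ` (D \<times> std_triangle)" and ?C = "q ` ((F - D) \<times> std_triangle)"
  have "openin (top_of_set (sphere 0 1)) ?A" "openin (top_of_set (sphere 0 1)) ?C"
    by (rule open_image[OF D(1) sat_eq]; simp) (rule open_image[OF sub sat_eq]; simp)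
  moreover have "sphere 0 1 \<subseteq> ?A \<union> ?C"
  proof -
    have "F \<times> std_triangle \<subseteq> D \<times> std_triangle \<union> (F - D) \<times> std_triangle"
      by (auto simp: mem_Times_iff)
    then have "q ` (F \<times> std_triangle) \<subseteq> ?A \<union> ?C" by (metis image_Un image_mono)
    then show ?thesis by (simp only: q_image)
  qed
  moreover have "?A \<inter> ?C = {}"
  proof (intro equals0I, elim IntE)
    fix w assume w: "w \<in> ?A" "w \<in> ?C"
    from w(2) obtain z where z: "w = q z" "z \<in> (F - D) \<times> std_triangle" by (rule imageE)
    have "z \<in> F \<times> std_triangle" using z(2) by (simp add: mem_Times_iff)
    then have "z \<in> D \<times> std_triangle" using w(1) unfolding z(1) by (rule sat[OF disjI1[OF refl]])
    then show False using z(2) by (simp add: mem_Times_iff)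
  qed
  moreover have "std_triangle \<noteq> {}" by (simp add: std_triangle_def)
  then have "?A \<noteq> {}" "?C \<noteq> {}" using D by auto
  ultimately have "\<not> connected (sphere 0 1 :: (real^3) set)"
    unfolding connected_openin not_not by (intro exI conjI)
  moreover have "connected (sphere 0 1 :: (real^3) set)" by (rule connected_sphere) simp
  ultimately show False ..
qed

lemma corner_point_glue:
  assumes T: "sphere_triangulation F g q" and d: "fst d \<in> F"
  shows "q (corner_point (next_side (g d))) = q (corner_point d)"
proof -
  have gd: "fst (g d) \<in> F" using T d by (auto simp: sphere_triangulation_def side_gluing_def)
  have "corner_point d = side_point d 0" "corner_point (next_side (g d)) = side_point (g d) (1 - 0)"
    by (simp_all add: corner_point_def side_point_def)
  then have "(corner_point d, corner_point (next_side (g d))) \<in> glue_rel F g"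
    using d unfolding glue_rel_def by (intro CollectI exI[of _ d] exI[of _ 0]) simp
  then have rel: "(corner_point d, corner_point (next_side (g d))) \<in> (glue_rel F g)\<^sup>*" by (rule r_into_rtrancl)
  have mem: "corner_point e \<in> F \<times> std_triangle" if "fst e \<in> F" for e :: "'a \<times> 3"
    using that by (auto simp: corner_point_def std_triangle_def intro: hull_inc)
  have "fst (next_side (g d)) \<in> F" using gd by simp
  from sphere_triangulation_fibre[OF T mem[OF d] mem[OF this]] show ?thesis using rel by simp
qed

text \<open>Counting corners by vertices gives \<open>3 F = 2 * 3 + 6 (V - 3)\<close>, that is,
  \<open>F = 2 V - 4\<close>.\<close>

lemma euler_from_degrees:
  assumes "finite F"
    and deg: "\<forall>v\<in>vertices F q. vertex_degree F q v = 6 \<or> vertex_degree F q v = 2"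
    and three: "card {v \<in> vertices F q. vertex_degree F q v = 2} = 3"
  shows "2 * card (vertices F q) = card F + 4"
proof -
  let ?V = "vertices F q" and ?T = "{v \<in> vertices F q. vertex_degree F q v = 2}"
  have finV: "finite ?V" using assms by (simp add: vertices_def)
  have "3 * card F = (\<Sum>v\<in>?V. vertex_degree F q v)"
    using sum.image_gen[OF finite_sides[OF assms(1)], of "\<lambda>_. 1::nat" "\<lambda>d. q (corner_point d)"]
    by (simp add: card_sides vertices_def vertex_degree_def corners_at_def)
  also have "\<dots> = (\<Sum>v\<in>?T. vertex_degree F q v) + (\<Sum>v\<in>?V - ?T. vertex_degree F q v)"
    using finV by (subst sum.subset_diff[of ?T ?V]) auto
  also have "(\<Sum>v\<in>?T. vertex_degree F q v) = 2 * card ?T" by simp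
  also have "(\<Sum>v\<in>?V - ?T. vertex_degree F q v) = (\<Sum>v\<in>?V - ?T. 6)"
    using deg by (intro sum.cong) auto
  also have "\<dots> = 6 * (card ?V - card ?T)" using finV by (simp add: card_Diff_subset)
  finally show ?thesis using three card_mono[of ?V ?T] finV by simp
qed

lemma mod_3_eq_imp_of_nat_eq:
  assumes "[a = b] (mod 3)"
  shows "of_nat a = (of_nat b :: 3)"
proof -
  have "of_nat n = (of_nat (n mod 3) :: 3)" for n
  proof -
    have "of_nat n = (of_nat (3 * (n div 3) + n mod 3) :: 3)" by simp
    also have "\<dots> = of_nat (n mod 3)" by (simp only: of_nat_add of_nat_mult) simp
    finally show ?thesis .
  qed
  then show ?thesis using assms by (metis cong_def)
qed

theorem theorem1p2:
  fixes F :: "'f set"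
    and g :: "'f \<times> 3 \<Rightarrow> 'f \<times> 3"
    and q :: "'f \<times> (real^3) \<Rightarrow> real^3"
    and black :: "'f \<Rightarrow> bool"
  assumes "sphere_triangulation F g q"
    and "\<forall>v\<in>vertices F q. vertex_degree F q v = 6 \<or> vertex_degree F q v = 2"
    and "card {v \<in> vertices F q. vertex_degree F q v = 2} = 3"
    and "good_coloring F q black"
  shows "(real (fold_count F g black))\<^sup>2 / real (card F) \<ge> 3"
proof -
  define vtx where "vtx d = q (corner_point d)" for d
  have fin: "finite F" and gluing: "side_gluing F g"
    using assms(1) by (simp_all add: sphere_triangulation_def)
  have corners: "corners_at F q v = {d. fst d \<in> F \<and> vtx d = v}" for v
    by (simp add: corners_at_def vtx_def)
  have finC: "finite {d. fst d \<in> F \<and> vtx d = v}" for v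
    by (rule finite_subset[OF _ finite_sides[OF fin]]) auto
  have no_corners: "{d. fst d \<in> F \<and> vtx d = v} = {}" if "v \<notin> vertices F q" for v
    using that by (auto simp: vertices_def vtx_def)
  interpret balanced_coloring F g vtx black
  proof
    show "finite F" "side_gluing F g" by fact+
    show "vtx (next_side (g d)) = vtx d" if "fst d \<in> F" for d
      using corner_point_glue[OF assms(1) that] by (simp add: vtx_def)
    show "\<exists>d\<in>sides D. fst (g d) \<notin> D" if "D \<subseteq> F" "D \<noteq> {}" "D \<noteq> F" for D
      using sphere_triangulation_dual_connected[OF assms(1) that] .
    show "2 * card (vtx ` sides F) = card F + 4"
      using euler_from_degrees[OF fin assms(2,3)] by (simp add: vertices_def vtx_def[abs_def])
    show "even (card {d. fst d \<in> F \<and> vtx d = v})" for v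
    proof (cases "v \<in> vertices F q")
      case True
      then show ?thesis using assms(2) by (auto simp: vertex_degree_def corners)
    next
      case False
      show ?thesis unfolding no_corners[OF False] by simp
    qed
    show "(\<Sum>d | fst d \<in> F \<and> vtx d = v. if black (fst d) then 1 else - 1 :: 3) = 0" for v
    proof (cases "v \<in> vertices F q")
      case True
      let ?C = "{d. fst d \<in> F \<and> vtx d = v}"
      have "(\<Sum>d\<in>?C. if black (fst d) then 1 else - 1 :: 3)
          = of_nat (card {d \<in> ?C. black (fst d)}) - of_nat (card {d \<in> ?C. \<not> black (fst d)})"
        by (subst sum.If_cases[OF finC]) (simp add: Collect_conj_eq Compl_eq Int_assoc)
      also have "\<dots> = 0"
        using assms(4) True mod_3_eq_imp_of_nat_eq by (simp add: good_coloring_def corners)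
      finally show ?thesis .
    next
      case False
      show ?thesis by (simp only: no_corners[OF False] sum.empty)
    qed
  qed
  let ?f = "fold_count F g black"
  have "6 * card {t \<in> F. black t = b} \<le> ?f\<^sup>2" for b
  proof -
    let ?S = "{d. fst d \<in> F \<and> black (fst d) = b \<and> black (fst (g d)) \<noteq> b}"
    \<comment> \<open>An edge between two colors has exactly one side in a face of color
      \<open>b\<close>.\<close>
    have "card ?S \<le> ?f"
      unfolding fold_count_def
    proof (rule card_inj_on_le)
      show "inj_on (\<lambda>d. {d, g d}) ?S"
      proof (rule inj_onI)
        fix d e assume "d \<in> ?S" "e \<in> ?S" "{d, g d} = {e, g e}"
        moreover from this have "d \<noteq> g e" by auto
        ultimately show "d = e" by (simp add: doubleton_eq_iff)
      qed
      show "(\<lambda>d. {d, g d}) ` ?S \<subseteq> {e \<in> edges F g. \<exists>d\<in>e. \<exists>d'\<in>e. black (fst d) \<noteq> black (fst d')}"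
      proof (rule image_subsetI)
        fix d assume d: "d \<in> ?S"
        then have "{d, g d} \<in> edges F g" unfolding edges_def by (intro imageI) simp
        moreover have "black (fst d) \<noteq> black (fst (g d))" using d by simp
        ultimately show "{d, g d} \<in> {e \<in> edges F g. \<exists>d\<in>e. \<exists>d'\<in>e. black (fst d) \<noteq> black (fst d')}"
          by blast
      qed
      show "finite {e \<in> edges F g. \<exists>d\<in>e. \<exists>d'\<in>e. black (fst d) \<noteq> black (fst d')}"
        using fin by (simp add: edges_def)
    qed
    then have "(card ?S)\<^sup>2 \<le> ?f\<^sup>2" by (simp add: power_mono)
    then show ?thesis using color_class_bound[of b] by linarith
  qed
  from this[of True] this[of False]
  have "6 * (card {t \<in> F. black t} + card {t \<in> F. \<not> black t}) \<le> 2 * ?f\<^sup>2" by simp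
  moreover have "card {t \<in> F. black t} + card {t \<in> F. \<not> black t} = card F"
  proof -
    have "F = {t \<in> F. black t} \<union> {t \<in> F. \<not> black t}" by blast
    moreover have "card ({t \<in> F. black t} \<union> {t \<in> F. \<not> black t}) = card {t \<in> F. black t} + card {t \<in> F. \<not> black t}"
      by (rule card_Un_disjoint) (use fin in auto)
    ultimately show ?thesis by simp
  qed
  ultimately have "3 * card F \<le> ?f\<^sup>2" by simp
  then have "3 * real (card F) \<le> (real ?f)\<^sup>2" 
    by (metis of_nat_le_iff of_nat_mult of_nat_numeral of_nat_power)
  \<comment> \<open>Division by zero would give 0; the vertices of degree 2 rule this out.\<close>
  moreover have "card F > 0"
  proof -
    have "F \<noteq> {}"
    proof
      assume "F = {}"
      then have "vertices F q = {}" by (simp add: vertices_def sides_def)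
      then show False using assms(3) by simp
    qed
    then show ?thesis using fin by (simp add: card_gt_0_iff)
  qed
  ultimately show ?thesis by (simp add: pos_le_divide_eq)
qed

end
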